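(* Let $\mathcal{M}=(Q,\Sigma,\cdot,\circ)$ be a bireversible Mealy automaton. For every $\xi\in\Sigma^\omega$, $\xi$ is a singular point if and only if $\mathrm{Stab}(\xi)\neq\{1\}$.
   Context: A Mealy automaton is $\mathcal{M}=(Q,\Sigma,\cdot,\circ)$ with finite nonempty sets $Q$ (states) and $\Sigma$ (alphabet), a transition function $(q,a)\mapsto q\cdot a\in Q$ and a production function $(q,a)\mapsto q\circ a\in\Sigma$; write $q\xrightarrow{a|b}p$ when $q\cdot a=p$, $q\circ a=b$. Extend by $q\circ(a_1\cdots a_n)=(q\circ a_1)\big((q\cdot a_1)\circ(a_2\cdots a_n)\big)$. It is invertible if each map $a\mapsto q\circ a$ is a permutation of $\Sigma$, reversible if each map $q\mapsto q\cdot a$ is a permutation of $Q$, and bireversible if it is invertible, reversible and, for each $b\in\Sigma$, the map sending $q$ to the target of its unique transition with output letter $b$ is a permutation of $Q$. For an invertible automaton each $q$ acts as an automorphism of the rooted tree $\Sigma^*$; $\langle\mathcal{M}\rangle$ is the group generated by these automorphisms (identity $1$), acting on the boundary $\Sigma^\omega$. $\mathrm{Stab}(\xi)=\{g\in\langle\mathcal{M}\rangle:g\circ\xi=\xi\}$. A point $\xi\in\Sigma^\omega$ is singular if the map $\xi\mapsto\mathrm{Stab}(\xi)$ from $\Sigma^\omega$ (product topology) to the space of subgroups of $\langle\mathcal{M}\rangle$ (topology induced from the product topology of $\{0,1\}^{\langle\mathcal{M}\rangle}$) is not continuous at $\xi$. *)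

theory Defs
  imports "HOL-Analysis.Analysis" "HOL-Algebra.Bij" "HOL-Algebra.Generated_Groups"
begin

record ('q, 's) mealy =
  transition :: "'q \<Rightarrow> 's \<Rightarrow> 'q"
  production :: "'q \<Rightarrow> 's \<Rightarrow> 's"

definition mealy_invertible :: "('q, 's) mealy \<Rightarrow> bool" where
  "mealy_invertible M \<longleftrightarrow> (\<forall>q. bij (\<lambda>a. production M q a))"

definition mealy_reversible :: "('q, 's) mealy \<Rightarrow> bool" where
  "mealy_reversible M \<longleftrightarrow> (\<forall>a. bij (\<lambda>q. transition M q a))"

text \<open>In the third condition the definite description is meaningful because \<open>M\<close> is invertible.\<close>

definition mealy_bireversible :: "('q, 's) mealy \<Rightarrow> bool" where
  "mealy_bireversible M \<longleftrightarrow> mealy_invertible M \<and> mealy_reversible M \<and>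
     (\<forall>b. bij (\<lambda>q. transition M q (THE a. production M q a = b)))"

primrec word_act :: "('q, 's) mealy \<Rightarrow> 'q \<Rightarrow> 's list \<Rightarrow> 's list" where
  "word_act M q [] = []"
| "word_act M q (a # w) = production M q a # word_act M (transition M q a) w"

text \<open>
  The group is generated inside the group of all bijections of the set of finite words. For an
  invertible automaton the generators are tree automorphisms, which form a subgroup of it, so
  this is the group they generate there. The operation is composition \<open>g \<circ> h\<close>.
\<close>

definition mealy_group :: "('q, 's) mealy \<Rightarrow> ('s list \<Rightarrow> 's list) monoid" where
  "mealy_group M = subgroup_generated (BijGroup (UNIV :: 's list set)) (range (word_act M))"

text \<open>
  A tree automorphism preserves lengths and prefixes, hence extends uniquely and continuously to
  infinite words: the letter at position \<open>n\<close> of the image is the last letter of the image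
  of the prefix of length \<open>n + 1\<close>.
\<close>

definition boundary_act :: "('s list \<Rightarrow> 's list) \<Rightarrow> (nat \<Rightarrow> 's) \<Rightarrow> (nat \<Rightarrow> 's)" where
  "boundary_act g \<xi> = (\<lambda>n. g (map \<xi> [0..<Suc n]) ! n)"

definition mealy_stab :: "('q, 's) mealy \<Rightarrow> (nat \<Rightarrow> 's) \<Rightarrow> ('s list \<Rightarrow> 's list) set" where
  "mealy_stab M \<xi> = {g \<in> carrier (mealy_group M). boundary_act g \<xi> = \<xi>}"

definition boundary_topology :: "(nat \<Rightarrow> 's) topology" where
  "boundary_topology = product_topology (\<lambda>_. discrete_topology UNIV) UNIV"

text \<open>
  The space of subgroups of \<open>G\<close>. A subgroup is identified with its indicator function on
  \<open>carrier G\<close>; points of the product over \<open>carrier G\<close> are extensional functions, whence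
  the restricted abstraction.
\<close>

definition subgroup_topology :: "('g, 'm) monoid_scheme \<Rightarrow> 'g set topology" where
  "subgroup_topology G =
     pullback_topology {H. subgroup H G} (\<lambda>H. \<lambda>g\<in>carrier G. g \<in> H)
       (product_topology (\<lambda>_. discrete_topology (UNIV :: bool set)) (carrier G))"

definition singular_point :: "('q, 's) mealy \<Rightarrow> (nat \<Rightarrow> 's) \<Rightarrow> bool" where
  "singular_point M \<xi> \<longleftrightarrow>
     \<not> topcontinuous_at boundary_topology (subgroup_topology (mealy_group M)) (mealy_stab M) \<xi>"

end

theory Submission
  imports Defs
begin

text \<open>
  Neighbouring boundary points share long prefixes, so an element that moves \<open>\<xi>\<close> also moves every
  point near \<open>\<xi>\<close>. Hence stabilisers vary continuously at \<open>\<xi>\<close> exactly when every element fixing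
  \<open>\<xi>\<close> fixes a whole cylinder around \<open>\<xi>\<close> pointwise
  (\<open>topcontinuous_at_mealy_stab_iff\<close> together with \<open>mem_mealy_stab_iff\<close>).

  For a bireversible automaton only the identity fixes a cylinder pointwise
  (\<open>mealy_group_eq_id_if_fixes_cylinder\<close>). Fixing the cylinder of a word \<open>w\<close> means that the
  section at \<open>w\<close> is trivial. Each group element is given by a tuple of states and inverse states;
  bireversibility says precisely that, for a fixed letter, taking sections is injective on these
  tuples. As it preserves the length of the tuple, and there are finitely many tuples of each
  length, every tuple is recovered from its section at a letter by taking
  further sections at the same letter (\<open>word_act_id_if_section_id\<close>). Since sections of the identity
  are trivial, an element with one trivial section is trivial.

  So continuity at \<open>\<xi>\<close> forces the stabiliser of \<open>\<xi>\<close> to be trivial; conversely, a trivial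
  stabiliser consists of the identity, which fixes every cylinder.
\<close>

section \<open>Triviality of sections\<close>

lemma length_word_act [simp]: "length (word_act M q w) = length w"
  by (induction w arbitrary: q) auto

lemma take_word_act: "take n (word_act M q w) = word_act M q (take n w)"
  by (induction w arbitrary: q n) (auto simp: take_Cons split: nat.split)

text \<open>
  Triviality of the action passes from a state to its successors. Under the hypotheses \<open>q\<close>
  lies on a cycle of transitions by \<open>a\<close>, so it is also a successor of \<open>transition M q a\<close>.
\<close>

lemma word_act_id_if_section_id:
  assumes inj: "inj (\<lambda>q. transition M q a)"
    and fin: "finite {p. \<exists>n. p = ((\<lambda>q. transition M q a) ^^ n) q}"
    and triv: "word_act M (transition M q a) = id"
  shows "word_act M q = id"
proof -
  define f where "f = (\<lambda>q. transition M q a)"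
  obtain n where n: "n > 0" "(f ^^ n) q = q"
    using funpow_inj_finite[OF inj fin] unfolding f_def by blast
  have step: "word_act M (f p) = id" if "word_act M p = id" for p
  proof
    fix v
    have "word_act M p (a # v) = a # v" by (simp add: that)
    then show "word_act M (f p) v = id v" by (simp add: f_def)
  qed
  have "word_act M ((f ^^ Suc k) q) = id" for k
  proof (induction k)
    case 0
    show ?case using triv by (simp add: f_def)
  next
    case (Suc k)
    then show ?case using step by (metis funpow.simps(2) o_apply)
  qed
  from this[of "n - 1"] n show ?thesis by simp
qed

lemma word_act_id_if_fixes_extensions:
  assumes inj: "\<And>a. inj (\<lambda>q. transition M q a)"
    and fin: "\<And>a q. finite {p. \<exists>n. p = ((\<lambda>q. transition M q a) ^^ n) q}"
    and "\<And>v. word_act M q (w @ v) = w @ v"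
  shows "word_act M q = id"
  using assms(3)
proof (induction w arbitrary: q)
  case Nil
  then show ?case by auto
next
  case (Cons a w)
  have "word_act M (transition M q a) = id"
    by (rule Cons.IH) (use Cons.prems in simp)
  then show ?case by (rule word_act_id_if_section_id[OF inj fin])
qed

section \<open>Group elements as tuples of states and inverse states\<close>

text \<open>The disjoint union of \<open>M\<close> (first component \<open>True\<close>) and its inverse automaton.\<close>

definition with_inverse :: "('q, 's) mealy \<Rightarrow> (bool \<times> 'q, 's) mealy" where
  "with_inverse M = \<lparr>
     transition = (\<lambda>(b, q) a. (b, transition M q (if b then a else inv_into UNIV (production M q) a))),
     production = (\<lambda>(b, q) a. if b then production M q a else inv_into UNIV (production M q) a)\<rparr>"

primrec tuple_production :: "('q, 's) mealy \<Rightarrow> 'q list \<Rightarrow> 's \<Rightarrow> 's" where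
  "tuple_production M [] a = a"
| "tuple_production M (q # qs) a = production M q (tuple_production M qs a)"

primrec tuple_transition :: "('q, 's) mealy \<Rightarrow> 'q list \<Rightarrow> 's \<Rightarrow> 'q list" where
  "tuple_transition M [] a = []"
| "tuple_transition M (q # qs) a =
     transition M q (tuple_production M qs a) # tuple_transition M qs a"

text \<open>
  Cascade composition, with the last state of the list reading the input; a list of states then
  acts as the composition of its members in the order of the list.
\<close>

definition tuple_automaton :: "('q, 's) mealy \<Rightarrow> ('q list, 's) mealy" where
  "tuple_automaton M = \<lparr>transition = tuple_transition M, production = tuple_production M\<rparr>"

lemma word_act_tuple_Nil: "word_act (tuple_automaton M) [] = id"
proof
  show "word_act (tuple_automaton M) [] w = id w" for w
    by (induction w) (auto simp: tuple_automaton_def)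
qed

lemma word_act_tuple_Cons:
  "word_act (tuple_automaton M) (q # qs) = word_act M q \<circ> word_act (tuple_automaton M) qs"
proof
  show "word_act (tuple_automaton M) (q # qs) w
      = (word_act M q \<circ> word_act (tuple_automaton M) qs) w" for w
    by (induction w arbitrary: q qs) (auto simp: tuple_automaton_def)
qed

lemma word_act_tuple_append:
  "word_act (tuple_automaton M) (ps @ qs)
     = word_act (tuple_automaton M) ps \<circ> word_act (tuple_automaton M) qs"
  by (induction ps) (auto simp: word_act_tuple_Nil word_act_tuple_Cons)

lemma length_tuple_transition [simp]: "length (tuple_transition M qs a) = length qs"
  by (induction qs) auto

text \<open>
  The states are recovered from the last to the first: once the tail of the tuple is known, so is
  the letter that reaches its head, and the head is determined by its successor under that letter.
\<close>

lemma inj_tuple_transition: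
  assumes inj: "\<And>a. inj (\<lambda>q. transition M q a)"
  shows "inj (\<lambda>qs. tuple_transition M qs a)"
proof (rule injI)
  fix ps qs
  assume eq: "tuple_transition M ps a = tuple_transition M qs a"
  then have "length ps = length qs" by (metis length_tuple_transition)
  then show "ps = qs" using eq
    by (induction rule: list_induct2) (auto dest: injD[OF inj])
qed

lemma finite_tuple_transition_orbit:
  fixes M :: "('q::finite, 's) mealy"
  shows "finite {ps. \<exists>n. ps = ((\<lambda>qs. tuple_transition M qs a) ^^ n) qs}"
proof (rule finite_subset)
  have "length (((\<lambda>qs. tuple_transition M qs a) ^^ n) qs) = length qs" for n
    by (induction n) auto
  then show "{ps. \<exists>n. ps = ((\<lambda>qs. tuple_transition M qs a) ^^ n) qs}
      \<subseteq> {ps. set ps \<subseteq> UNIV \<and> length ps = length qs}"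
    by auto
  show "finite {ps :: 'q list. set ps \<subseteq> UNIV \<and> length ps = length qs}"
    by (rule finite_lists_length_eq) simp
qed

text \<open>
  Reversibility gives injectivity on the states; the condition on output letters gives it on the
  inverse states, whose input letters are the output letters of \<open>M\<close>.
\<close>

lemma inj_transition_with_inverse:
  assumes "mealy_bireversible M"
  shows "inj (\<lambda>p. transition (with_inverse M) p a)"
proof -
  have inj_prod: "inj (production M q)" for q
    using assms by (simp add: mealy_bireversible_def mealy_invertible_def bij_is_inj)
  have surj_prod: "surj (production M q)" for q
    using assms by (simp add: mealy_bireversible_def mealy_invertible_def bij_is_surj)
  have "(THE c. production M q c = a) = inv_into UNIV (production M q) a" for q
    using inj_prod surj_prod by (intro the_equality) (auto simp: surj_f_inv_f)
  moreover have "bij (\<lambda>q. transition M q (THE c. production M q c = a))"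
    using assms unfolding mealy_bireversible_def by blast
  ultimately have inj_False: "inj (\<lambda>q. transition M q (inv_into UNIV (production M q) a))"
    by (simp add: bij_is_inj)
  have inj_True: "inj (\<lambda>q. transition M q a)"
    using assms by (simp add: mealy_bireversible_def mealy_reversible_def bij_is_inj)
  show ?thesis
  proof (rule injI)
    fix p p'
    assume "transition (with_inverse M) p a = transition (with_inverse M) p' a"
    moreover obtain b q b' q' where "p = (b, q)" "p' = (b', q')" by (metis surj_pair)
    ultimately show "p = p'"
      using injD[OF inj_True, of q q'] injD[OF inj_False, of q q']
      by (cases b) (simp_all add: with_inverse_def)
  qed
qed

lemma word_act_with_inverse_True: "word_act (with_inverse M) (True, q) = word_act M q"
proof
  show "word_act (with_inverse M) (True, q) w = word_act M q w" for w
    by (induction w arbitrary: q) (auto simp: with_inverse_def)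
qed

lemma word_act_with_inverse_False:
  assumes "mealy_invertible M"
  shows "word_act (with_inverse M) (False, q) (word_act M q w) = w"
    and "word_act M q (word_act (with_inverse M) (False, q) w) = w"
proof -
  have "bij (production M q)" for q
    using assms by (simp add: mealy_invertible_def)
  then have [simp]: "inv_into UNIV (production M q) (production M q a) = a"
      "production M q (inv_into UNIV (production M q) a) = a" for q a
    by (simp_all add: bij_is_inj bij_is_surj surj_f_inv_f)
  show "word_act (with_inverse M) (False, q) (word_act M q w) = w"
    by (induction w arbitrary: q) (auto simp: with_inverse_def)
  show "word_act M q (word_act (with_inverse M) (False, q) w) = w"
    by (induction w arbitrary: q) (auto simp: with_inverse_def)
qed

lemma bij_word_act:
  assumes "mealy_invertible M"
  shows "bij (word_act M q)"
  using word_act_with_inverse_False[OF assms]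
  by (intro o_bij[of "word_act (with_inverse M) (False, q)"]) auto

lemma inv_word_act:
  assumes "mealy_invertible M"
  shows "inv_into UNIV (word_act M q) = word_act (with_inverse M) (False, q)"
  using word_act_with_inverse_False[OF assms] by (intro inv_equality)

lemma carrier_BijGroup_UNIV: "carrier (BijGroup UNIV) = {f. bij f}"
  by (auto simp: BijGroup_def Bij_def extensional_def)

lemma mult_BijGroup_UNIV: "bij f \<Longrightarrow> bij g \<Longrightarrow> f \<otimes>\<^bsub>BijGroup UNIV\<^esub> g = f \<circ> g"
  by (auto simp: BijGroup_def Bij_def extensional_def compose_def)

lemma one_BijGroup_UNIV: "\<one>\<^bsub>BijGroup UNIV\<^esub> = id"
  by (auto simp: BijGroup_def)

lemma inv_BijGroup_UNIV: "bij f \<Longrightarrow> inv\<^bsub>BijGroup UNIV\<^esub> f = inv_into UNIV f"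
  by (subst inv_BijGroup) (auto simp: Bij_def extensional_def)

lemma one_mealy_group: "\<one>\<^bsub>mealy_group M\<^esub> = id"
  by (simp add: mealy_group_def one_BijGroup_UNIV)

lemma mealy_group_subgroup: "subgroup (carrier (mealy_group M)) (BijGroup UNIV)"
  unfolding mealy_group_def by (rule group.subgroup_subgroup_generated[OF group_BijGroup])

lemma bij_mealy_group: "g \<in> carrier (mealy_group M) \<Longrightarrow> bij g"
  using subgroup.subset[OF mealy_group_subgroup] carrier_BijGroup_UNIV by blast

lemma id_in_mealy_group: "id \<in> carrier (mealy_group M)"
  using subgroup.one_closed[OF mealy_group_subgroup] by (simp add: one_BijGroup_UNIV)

lemma mealy_group_imp_tuple:
  assumes "mealy_invertible M" and g: "g \<in> carrier (mealy_group M)"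
  shows "\<exists>qs. g = word_act (tuple_automaton (with_inverse M)) qs"
proof -
  have "g \<in> generate (BijGroup UNIV) (carrier (BijGroup UNIV) \<inter> range (word_act M))"
    using g by (simp add: mealy_group_def carrier_subgroup_generated)
  then show ?thesis
  proof (induction rule: generate.induct)
    case one
    show ?case by (metis one_BijGroup_UNIV word_act_tuple_Nil)
  next
    case (incl h)
    then obtain q where "h = word_act M q" by blast
    then have "h = word_act (tuple_automaton (with_inverse M)) [(True, q)]"
      by (simp add: word_act_tuple_Cons word_act_tuple_Nil word_act_with_inverse_True)
    then show ?case by blast
  next
    case (inv h)
    then obtain q where "h = word_act M q" by blast
    then have "inv\<^bsub>BijGroup UNIV\<^esub> h = word_act (tuple_automaton (with_inverse M)) [(False, q)]"
      using assms(1)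
      by (simp add: word_act_tuple_Cons word_act_tuple_Nil inv_BijGroup_UNIV bij_word_act
          inv_word_act)
    then show ?case by blast
  next
    case (eng h1 h2)
    have "bij h1" "bij h2"
      using eng.hyps carrier_BijGroup_UNIV
        group.generate_in_carrier[OF group_BijGroup, of "carrier (BijGroup UNIV) \<inter> range (word_act M)"]
      by blast+
    then show ?case
      using eng.IH by (metis mult_BijGroup_UNIV word_act_tuple_append)
  qed
qed

text \<open>
  A tuple of states representing \<open>g\<close> lives in an automaton with injective transitions and finite
  orbits, where triviality of the section at \<open>w\<close> passes back along \<open>w\<close> to \<open>g\<close> itself.
\<close>

theorem mealy_group_eq_id_if_fixes_cylinder:
  fixes M :: "('q::finite, 's) mealy"
  assumes M: "mealy_bireversible M" and g: "g \<in> carrier (mealy_group M)"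
    and fix_cyl: "\<And>v. g (w @ v) = w @ v"
  shows "g = id"
proof -
  let ?T = "tuple_automaton (with_inverse M)"
  have "mealy_invertible M" using M by (simp add: mealy_bireversible_def)
  then obtain qs where qs: "g = word_act ?T qs"
    using mealy_group_imp_tuple g by blast
  have "word_act ?T qs = id"
  proof (rule word_act_id_if_fixes_extensions)
    show "inj (\<lambda>qs. transition ?T qs a)" for a
      using inj_tuple_transition[OF inj_transition_with_inverse[OF M]]
      by (simp add: tuple_automaton_def)
    show "finite {ps. \<exists>n. ps = ((\<lambda>qs. transition ?T qs a) ^^ n) qs}" for a qs
      using finite_tuple_transition_orbit by (simp add: tuple_automaton_def)
    show "word_act ?T qs (w @ v) = w @ v" for v
      using fix_cyl qs by simp
  qed
  with qs show ?thesis by simp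
qed

section \<open>Stabilisers of boundary points\<close>

lemma boundary_act_prefix:
  assumes "mealy_invertible M" and g: "g \<in> carrier (mealy_group M)"
  shows "map (boundary_act g \<xi>) [0..<n] = g (map \<xi> [0..<n])"
proof -
  obtain qs where qs: "g = word_act (tuple_automaton (with_inverse M)) qs"
    using mealy_group_imp_tuple[OF assms] by blast
  show ?thesis
  proof (rule nth_equalityI)
    fix i assume "i < length (map (boundary_act g \<xi>) [0..<n])"
    then have i: "i < n" by simp
    then have "map \<xi> [0..<Suc i] = take (Suc i) (map \<xi> [0..<n])"
      by (simp add: take_map)
    then have "g (map \<xi> [0..<Suc i]) = take (Suc i) (g (map \<xi> [0..<n]))"
      by (simp only: qs take_word_act)
    then show "map (boundary_act g \<xi>) [0..<n] ! i = g (map \<xi> [0..<n]) ! i"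
      using i unfolding boundary_act_def by simp
  qed (simp add: qs)
qed

text \<open>
  In this form membership in a stabiliser is a statement about finite prefixes: subgroup axioms
  and local constancy can be checked on one prefix at a time.
\<close>

lemma mem_mealy_stab_iff:
  assumes "mealy_invertible M"
  shows "g \<in> mealy_stab M \<xi> \<longleftrightarrow>
    g \<in> carrier (mealy_group M) \<and> (\<forall>n. g (map \<xi> [0..<n]) = map \<xi> [0..<n])"
proof -
  have "boundary_act g \<xi> = \<xi> \<longleftrightarrow> (\<forall>n. map (boundary_act g \<xi>) [0..<n] = map \<xi> [0..<n])"
  proof
    assume *: "\<forall>n. map (boundary_act g \<xi>) [0..<n] = map \<xi> [0..<n]"
    show "boundary_act g \<xi> = \<xi>"
    proof
      fix i
      have "map (boundary_act g \<xi>) [0..<Suc i] = map \<xi> [0..<Suc i]" using * by blast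
      then show "boundary_act g \<xi> i = \<xi> i" by simp
    qed
  qed simp
  then show ?thesis
    unfolding mealy_stab_def mem_Collect_eq
    using boundary_act_prefix[OF assms, of g \<xi>] by (simp cong: conj_cong del: map_eq_conv)
qed

lemma id_in_mealy_stab: "mealy_invertible M \<Longrightarrow> id \<in> mealy_stab M \<xi>"
  by (simp add: mem_mealy_stab_iff id_in_mealy_group)

lemma mealy_stab_subset: "mealy_stab M \<xi> \<subseteq> carrier (mealy_group M)"
  by (auto simp: mealy_stab_def)

lemma subgroup_mealy_stab:
  assumes "mealy_invertible M"
  shows "subgroup (mealy_stab M \<xi>) (mealy_group M)"
proof -
  note stab = mem_mealy_stab_iff[OF assms]
  have "subgroup (mealy_stab M \<xi>) (BijGroup UNIV)"
  proof (rule subgroup.intro)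
    show "mealy_stab M \<xi> \<subseteq> carrier (BijGroup UNIV)"
      using mealy_stab_subset subgroup.subset[OF mealy_group_subgroup] by blast
    show "\<one>\<^bsub>BijGroup UNIV\<^esub> \<in> mealy_stab M \<xi>"
      using assms by (simp add: one_BijGroup_UNIV id_in_mealy_stab)
  next
    fix g h assume gh: "g \<in> mealy_stab M \<xi>" "h \<in> mealy_stab M \<xi>"
    then have "g \<otimes>\<^bsub>BijGroup UNIV\<^esub> h \<in> carrier (mealy_group M)"
      by (simp add: stab subgroup.m_closed[OF mealy_group_subgroup])
    moreover have "g \<otimes>\<^bsub>BijGroup UNIV\<^esub> h = g \<circ> h"
      using gh by (intro mult_BijGroup_UNIV) (auto simp: stab intro: bij_mealy_group)
    ultimately show "g \<otimes>\<^bsub>BijGroup UNIV\<^esub> h \<in> mealy_stab M \<xi>"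
      using gh by (simp add: stab)
  next
    fix g assume g: "g \<in> mealy_stab M \<xi>"
    then have bij: "bij g" by (auto simp: stab intro: bij_mealy_group)
    have "inv\<^bsub>BijGroup UNIV\<^esub> g \<in> carrier (mealy_group M)"
      using g by (simp add: stab subgroup.m_inv_closed[OF mealy_group_subgroup])
    moreover have "inv_into UNIV g (map \<xi> [0..<n]) = map \<xi> [0..<n]" for n
      using g bij by (metis stab bij_inv_eq_iff)
    ultimately show "inv\<^bsub>BijGroup UNIV\<^esub> g \<in> mealy_stab M \<xi>"
      by (simp add: stab inv_BijGroup_UNIV bij)
  qed
  then show ?thesis
    using mealy_stab_subset[of M \<xi>]
    by (simp add: mealy_group_def group.subgroup_subgroup_generated_iff[OF group_BijGroup])
qed

section \<open>Continuity of the stabiliser map\<close>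

lemma openin_cylinder: "openin boundary_topology {\<eta>. \<forall>i<n. \<eta> i = \<xi> i}"
proof -
  have "{\<eta>. \<forall>i<n. \<eta> i = \<xi> i} = (\<Pi>\<^sub>E i\<in>UNIV. if i < n then {\<xi> i} else UNIV)"
    by (auto simp: PiE_iff split: if_splits)
  moreover have "finite {i. (if i < n then {\<xi> i} else UNIV) \<noteq> UNIV}"
    by (rule finite_subset[of _ "{..<n}"]) auto
  ultimately show ?thesis
    unfolding boundary_topology_def by (simp add: openin_PiE_gen)
qed

lemma openin_boundary_imp_cylinder:
  assumes "openin boundary_topology U" "\<xi> \<in> U"
  shows "\<exists>n. {\<eta>. \<forall>i<n. \<eta> i = \<xi> i} \<subseteq> U"
proof -
  obtain X where fin: "finite {i. X i \<noteq> UNIV}" and \<xi>: "\<And>i. \<xi> i \<in> X i" and X: "(\<Pi>\<^sub>E i\<in>UNIV. X i) \<subseteq> U"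
    using assms unfolding boundary_topology_def openin_product_topology_alt
    by (fastforce simp: PiE_iff)
  obtain n where n: "\<And>i. X i \<noteq> UNIV \<Longrightarrow> i < n"
    using fin unfolding finite_nat_set_iff_bounded by blast
  have "\<eta> i \<in> X i" if "\<forall>i<n. \<eta> i = \<xi> i" for \<eta> i
    using n[of i] \<xi>[of i] that by (cases "X i = UNIV") auto
  then have "{\<eta>. \<forall>i<n. \<eta> i = \<xi> i} \<subseteq> U" using X by (fastforce simp: PiE_iff)
  then show ?thesis ..
qed

text \<open>
  The topology on subgroups is that of pointwise convergence of indicator functions, so a map into
  it is continuous at a point iff the truth value of membership of each single element is locally
  constant there; a neighbourhood involves only finitely many elements, hence the
  maximum of finitely many prefix lengths works for all of them.
\<close>

lemma topcontinuous_at_subgroup_topology_iff: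
  assumes sub: "\<And>\<eta>. subgroup (F \<eta>) G"
  shows "topcontinuous_at boundary_topology (subgroup_topology G) F \<xi> \<longleftrightarrow>
    (\<forall>g\<in>carrier G. \<exists>n. \<forall>\<eta>. (\<forall>i<n. \<eta> i = \<xi> i) \<longrightarrow> (g \<in> F \<eta> \<longleftrightarrow> g \<in> F \<xi>))"
    (is "?cont \<longleftrightarrow> ?loc")
proof
  define ind where "ind = (\<lambda>H. \<lambda>g\<in>carrier G. g \<in> H)"
  note top_def = subgroup_topology_def[of G, folded ind_def]
  show ?loc if ?cont
  proof
    fix g assume g: "g \<in> carrier G"
    define W where "W = (\<Pi>\<^sub>E h\<in>carrier G. if h = g then {g \<in> F \<xi>} else UNIV)"
    have "finite {h \<in> carrier G. (if h = g then {g \<in> F \<xi>} else UNIV) \<noteq> UNIV}"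
      by (rule finite_subset[of _ "{g}"]) auto
    then have "openin (product_topology (\<lambda>_. discrete_topology (UNIV :: bool set)) (carrier G)) W"
      unfolding W_def by (simp add: openin_PiE_gen)
    moreover define V where "V = ind -` W \<inter> {H. subgroup H G}"
    ultimately have "openin (subgroup_topology G) V"
      unfolding top_def openin_pullback_topology by blast
    moreover have "F \<xi> \<in> V"
      using sub by (auto simp: ind_def W_def V_def)
    ultimately have "\<exists>U. openin boundary_topology U \<and> \<xi> \<in> U \<and> (\<forall>\<eta>\<in>U. F \<eta> \<in> V)"
      using \<open>?cont\<close> by (simp add: topcontinuous_at_def)
    then obtain U where "openin boundary_topology U" "\<xi> \<in> U"
      and U: "\<And>\<eta>. \<eta> \<in> U \<Longrightarrow> F \<eta> \<in> V"
      by blast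
    then obtain n where n: "{\<eta>. \<forall>i<n. \<eta> i = \<xi> i} \<subseteq> U"
      using openin_boundary_imp_cylinder by blast
    have "g \<in> F \<eta> \<longleftrightarrow> g \<in> F \<xi>" if "\<forall>i<n. \<eta> i = \<xi> i" for \<eta>
    proof -
      have "F \<eta> \<in> V" using U n that by blast
      then have "ind (F \<eta>) \<in> W" by (simp add: V_def)
      from PiE_mem[OF this[unfolded W_def] g] have "ind (F \<eta>) g = (g \<in> F \<xi>)" by simp
      then show ?thesis using g by (simp add: ind_def)
    qed
    then show "\<exists>n. \<forall>\<eta>. (\<forall>i<n. \<eta> i = \<xi> i) \<longrightarrow> (g \<in> F \<eta> \<longleftrightarrow> g \<in> F \<xi>)" by blast
  qed
  show ?cont if loc: ?loc
    unfolding topcontinuous_at_def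
  proof (intro conjI allI impI)
    show "\<xi> \<in> topspace boundary_topology"
      by (simp add: boundary_topology_def)
    show "F \<in> topspace boundary_topology \<rightarrow> topspace (subgroup_topology G)"
      using sub by (auto simp: top_def topspace_pullback_topology ind_def)
    fix V assume "openin (subgroup_topology G) V \<and> F \<xi> \<in> V"
    then obtain W where
      W: "openin (product_topology (\<lambda>_. discrete_topology (UNIV :: bool set)) (carrier G)) W"
      and V: "V = ind -` W \<inter> {H. subgroup H G}" and FV: "F \<xi> \<in> V"
      unfolding top_def openin_pullback_topology by blast
    have FW: "ind (F \<xi>) \<in> W" using V FV by blast
    obtain X where fin: "finite {g \<in> carrier G. X g \<noteq> UNIV}"
      and FX: "ind (F \<xi>) \<in> (\<Pi>\<^sub>E g\<in>carrier G. X g)" and XW: "(\<Pi>\<^sub>E g\<in>carrier G. X g) \<subseteq> W"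
      using W FW unfolding openin_product_topology_alt topspace_discrete_topology by blast
    obtain m where m: "\<And>g \<eta>. g \<in> carrier G \<Longrightarrow> \<forall>i<m g. \<eta> i = \<xi> i \<Longrightarrow> g \<in> F \<eta> \<longleftrightarrow> g \<in> F \<xi>"
      using loc by metis
    obtain N where N: "\<And>g. g \<in> carrier G \<Longrightarrow> X g \<noteq> UNIV \<Longrightarrow> m g \<le> N"
      using finite_imageI[OF fin, of m] unfolding finite_nat_set_iff_bounded_le by blast
    have "F \<eta> \<in> V" if \<eta>: "\<forall>i<N. \<eta> i = \<xi> i" for \<eta>
    proof -
      have "ind (F \<eta>) g \<in> X g" if g: "g \<in> carrier G" for g
      proof (cases "X g = UNIV")
        case False
        have "\<forall>i<m g. \<eta> i = \<xi> i"
          using \<eta> N[OF g False] by (meson less_le_trans)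
        then have "g \<in> F \<eta> \<longleftrightarrow> g \<in> F \<xi>" by (rule m[OF g])
        then have "ind (F \<eta>) g = ind (F \<xi>) g" using g by (simp add: ind_def)
        then show ?thesis using PiE_mem[OF FX g] by simp
      qed simp
      then have "ind (F \<eta>) \<in> (\<Pi>\<^sub>E g\<in>carrier G. X g)"
        by (auto simp: PiE_iff ind_def)
      then show ?thesis using XW V sub by auto
    qed
    then show "\<exists>U. openin boundary_topology U \<and> \<xi> \<in> U \<and> (\<forall>\<eta>\<in>U. F \<eta> \<in> V)"
      using openin_cylinder[of N \<xi>] by blast
  qed
qed

text \<open>
  Only elements of the stabiliser need attention: an element that moves \<open>\<xi>\<close> moves some
  prefix of \<open>\<xi>\<close>, and with it all points sharing that prefix.
\<close>

lemma topcontinuous_at_mealy_stab_iff: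
  assumes "mealy_invertible M"
  shows "topcontinuous_at boundary_topology (subgroup_topology (mealy_group M)) (mealy_stab M) \<xi>
    \<longleftrightarrow> (\<forall>g\<in>mealy_stab M \<xi>. \<exists>n. \<forall>\<eta>. (\<forall>i<n. \<eta> i = \<xi> i) \<longrightarrow> g \<in> mealy_stab M \<eta>)"
proof -
  define near where "near P \<longleftrightarrow> (\<exists>n. \<forall>\<eta>. (\<forall>i<n. \<eta> i = \<xi> i) \<longrightarrow> P \<eta>)" for P
  have moves: "near (\<lambda>\<eta>. g \<notin> mealy_stab M \<eta>)"
    if g: "g \<in> carrier (mealy_group M)" "g \<notin> mealy_stab M \<xi>" for g
  proof -
    obtain n where n: "g (map \<xi> [0..<n]) \<noteq> map \<xi> [0..<n]"
      using g mem_mealy_stab_iff[OF assms, of g \<xi>] by blast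
    have "g \<notin> mealy_stab M \<eta>" if "\<forall>i<n. \<eta> i = \<xi> i" for \<eta>
    proof -
      have "map \<eta> [0..<n] = map \<xi> [0..<n]" using that by simp
      then show ?thesis using n mem_mealy_stab_iff[OF assms, of g \<eta>] by metis
    qed
    then show ?thesis unfolding near_def by blast
  qed
  have "near (\<lambda>\<eta>. g \<in> mealy_stab M \<eta> \<longleftrightarrow> g \<in> mealy_stab M \<xi>)
      \<longleftrightarrow> (g \<in> mealy_stab M \<xi> \<longrightarrow> near (\<lambda>\<eta>. g \<in> mealy_stab M \<eta>))"
    if "g \<in> carrier (mealy_group M)" for g
    using moves[OF that] by (cases "g \<in> mealy_stab M \<xi>") simp_all
  then show ?thesis
    unfolding topcontinuous_at_subgroup_topology_iff[OF subgroup_mealy_stab[OF assms]]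
      near_def[symmetric]
    using mealy_stab_subset[of M \<xi>] by blast
qed

theorem proposition4p11:
  fixes M :: "('q::finite, 's::finite) mealy"
  assumes "mealy_bireversible M"
  shows "\<forall>\<xi> :: nat \<Rightarrow> 's. singular_point M \<xi> \<longleftrightarrow> mealy_stab M \<xi> \<noteq> {\<one>\<^bsub>mealy_group M\<^esub>}"
proof
  fix \<xi> :: "nat \<Rightarrow> 's"
  have inv: "mealy_invertible M" using assms by (simp add: mealy_bireversible_def)
  note stab = mem_mealy_stab_iff[OF inv]
  have only_id: "g = id"
    if g: "g \<in> carrier (mealy_group M)"
      and cyl: "\<And>\<eta>. \<forall>i<n. \<eta> i = \<xi> i \<Longrightarrow> g \<in> mealy_stab M \<eta>" for g n
  proof (rule mealy_group_eq_id_if_fixes_cylinder[OF assms g])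
    fix v
    let ?w = "map \<xi> [0..<n]"
    \<comment> \<open>A point of the cylinder with prefix \<open>?w @ v\<close>; beyond that prefix its letters are arbitrary.\<close>
    define \<eta> where "\<eta> i = (if i < n + length v then (?w @ v) ! i else \<xi> i)" for i
    have "\<forall>i<n. \<eta> i = \<xi> i" by (simp add: \<eta>_def nth_append)
    moreover have "map \<eta> [0..<n + length v] = ?w @ v"
      by (rule nth_equalityI) (auto simp: \<eta>_def)
    ultimately show "g (?w @ v) = ?w @ v"
      using cyl[of \<eta>] stab[of g \<eta>] by metis
  qed
  have "topcontinuous_at boundary_topology (subgroup_topology (mealy_group M)) (mealy_stab M) \<xi>
      \<longleftrightarrow> mealy_stab M \<xi> = {id}"
    unfolding topcontinuous_at_mealy_stab_iff[OF inv]
  proof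
    assume loc: "\<forall>g\<in>mealy_stab M \<xi>. \<exists>n. \<forall>\<eta>. (\<forall>i<n. \<eta> i = \<xi> i) \<longrightarrow> g \<in> mealy_stab M \<eta>"
    have "g = id" if g: "g \<in> mealy_stab M \<xi>" for g
    proof -
      obtain n where "\<forall>\<eta>. (\<forall>i<n. \<eta> i = \<xi> i) \<longrightarrow> g \<in> mealy_stab M \<eta>"
        using loc g by blast
      then show "g = id"
        using only_id[of g n] mealy_stab_subset[of M \<xi>] g by blast
    qed
    then show "mealy_stab M \<xi> = {id}"
      using id_in_mealy_stab[OF inv, of \<xi>] by blast
  next
    assume "mealy_stab M \<xi> = {id}"
    then show "\<forall>g\<in>mealy_stab M \<xi>. \<exists>n. \<forall>\<eta>. (\<forall>i<n. \<eta> i = \<xi> i) \<longrightarrow> g \<in> mealy_stab M \<eta>"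
      using id_in_mealy_stab[OF inv] by simp
  qed
  then show "singular_point M \<xi> \<longleftrightarrow> mealy_stab M \<xi> \<noteq> {\<one>\<^bsub>mealy_group M\<^esub>}"
    by (simp add: singular_point_def one_mealy_group)
qed

end
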